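(* For all $n,t\in\mathbb{N}$, any one-way communication protocol for the 2-party independence testing problem $\mathrm{IT}_{n,n,t,1}$ requires $\Omega(\sqrt{n})$ bits of communication.
   Context: $\mathrm{IT}_{n,m,t,\epsilon}$: $p=(a,b)$ is a joint distribution over $[n]\times[m]$; $t$ i.i.d. samples $\zeta_1,\dots,\zeta_t\sim p$ are drawn, Alice receives their first coordinates and Bob their second coordinates (indexed). The goal is to output, with probability at least $2/3$, whether $p$ is a product distribution or $p$ is $\epsilon$-far in $\ell_1$ distance from every product distribution. A one-way protocol consists of a single message from Alice to Bob (shared public randomness allowed), after which Bob outputs the answer. *)

theory Defs
  imports "HOL-Probability.Probability"
begin

definition dist_over :: "nat \<Rightarrow> nat \<Rightarrow> (nat \<times> nat) pmf \<Rightarrow> bool" where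
  "dist_over n m p \<longleftrightarrow> set_pmf p \<subseteq> {1..n} \<times> {1..m}"

definition product_dist_over :: "nat \<Rightarrow> nat \<Rightarrow> (nat \<times> nat) pmf \<Rightarrow> bool" where
  "product_dist_over n m p \<longleftrightarrow>
     (\<exists>q r. set_pmf q \<subseteq> {1..n} \<and> set_pmf r \<subseteq> {1..m} \<and> p = pair_pmf q r)"

definition l1_dist :: "nat \<Rightarrow> nat \<Rightarrow> (nat \<times> nat) pmf \<Rightarrow> (nat \<times> nat) pmf \<Rightarrow> real" where
  "l1_dist n m p q = (\<Sum>z\<in>{1..n} \<times> {1..m}. \<bar>pmf p z - pmf q z\<bar>)"

definition far_from_product :: "nat \<Rightarrow> nat \<Rightarrow> real \<Rightarrow> (nat \<times> nat) pmf \<Rightarrow> bool" where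
  "far_from_product n m \<epsilon> p \<longleftrightarrow> (\<forall>q. product_dist_over n m q \<longrightarrow> l1_dist n m p q \<ge> \<epsilon>)"

text \<open>
  The public coins are a finite bit string with an arbitrary distribution. For fixed
  parameters and bounded message length there are only finitely many deterministic
  protocols, so richer sources of randomness, and private coins, add nothing.
  Bob's answer \<open>True\<close> means ``product''.
\<close>

record one_way_protocol =
  coins :: "bool list pmf"
  alice :: "bool list \<Rightarrow> nat list \<Rightarrow> bool list"
  bob :: "bool list \<Rightarrow> bool list \<Rightarrow> nat list \<Rightarrow> bool"

definition bob_answer :: "one_way_protocol \<Rightarrow> nat \<Rightarrow> (nat \<times> nat) pmf \<Rightarrow> bool pmf" where
  "bob_answer P t p =
     bind_pmf (coins P) (\<lambda>\<omega>. bind_pmf (replicate_pmf t p) (\<lambda>zs.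
       return_pmf (bob P \<omega> (alice P \<omega> (map fst zs)) (map snd zs))))"

definition solves_IT ::
    "nat \<Rightarrow> nat \<Rightarrow> nat \<Rightarrow> real \<Rightarrow> one_way_protocol \<Rightarrow> bool" where
  "solves_IT n m t \<epsilon> P \<longleftrightarrow>
     (\<forall>p. dist_over n m p \<longrightarrow>
       (product_dist_over n m p \<longrightarrow> measure_pmf.prob (bob_answer P t p) {True} \<ge> 2 / 3) \<and>
       (far_from_product n m \<epsilon> p \<longrightarrow> measure_pmf.prob (bob_answer P t p) {False} \<ge> 2 / 3))"

text \<open>Worst case over Alice's inputs in \<open>[n]\<^sup>t\<close> and over the public coins.\<close>

definition communicates_at_most :: "nat \<Rightarrow> nat \<Rightarrow> one_way_protocol \<Rightarrow> nat \<Rightarrow> bool" where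
  "communicates_at_most n t P k \<longleftrightarrow>
     (\<forall>\<omega>\<in>set_pmf (coins P). \<forall>xs. set xs \<subseteq> {1..n} \<and> length xs = t \<longrightarrow>
       length (alice P \<omega> xs) \<le> k)"

end

theory Submission
  imports Defs
begin

text \<open>
  Let \<open>G\<close> be an abelian group of order 4 and \<open>m = n div 4\<close>. Alice's letters are elements of \<open>G\<close>,
  Bob's letters are pairs \<open>(i, c)\<close> with \<open>i < m\<close> and \<open>c \<in> G\<close>. For a random \<open>h : [m] \<rightarrow> G\<close>, the far
  distribution draws Bob's letter uniformly and sets Alice's letter to \<open>c + h i\<close>; the product
  distribution draws both letters uniformly and independently.

  Fix the coins and an Alice message with preimage \<open>A\<close> of density \<open>r\<close>. Bob's advantage is controlled
  by the second moment, over his input \<open>y\<close>, of the probability over \<open>h\<close> that Alice's word lies in \<open>A\<close>.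
  Expanding the square with two copies \<open>h, h'\<close> turns this into the probability that a uniform word and
  its shift by \<open>h' - h\<close> at random indices both lie in \<open>A\<close>. This is a product channel whose
  single-letter noise is the empirical distribution of \<open>h' - h\<close>, at distance about \<open>\<delta> = O(1/sqrt m)\<close>
  from uniform, so two-function hypercontractivity bounds it by \<open>r\<^sup>2\<close> times \<open>(1/r)\<close> to the power
  \<open>O(\<delta>)\<close>. Summing over \<open>2^(k+1)\<close> messages, the squared advantage is at most
  \<open>E exp (O(k \<delta>)) - 1 = O(k / sqrt m)\<close>.
\<close>

section \<open>Uniform averages and words\<close>

text \<open>Division by zero gives the value 0 on an empty or infinite \<open>A\<close>, so
  linearity and swapping hold for every set; only the average of a constant asks for a finite
  nonempty one.\<close>

definition avg :: "'a set \<Rightarrow> ('a \<Rightarrow> real) \<Rightarrow> real" where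
  "avg A f = (\<Sum>x\<in>A. f x) / real (card A)"

definition words :: "nat \<Rightarrow> 'a set \<Rightarrow> 'a list set" where
  "words t A = {xs. set xs \<subseteq> A \<and> length xs = t}"

lemma avg_cong: "(\<And>x. x \<in> A \<Longrightarrow> f x = g x) \<Longrightarrow> avg A f = avg A g"
  by (simp add: avg_def)

lemma avg_mono: "(\<And>x. x \<in> A \<Longrightarrow> f x \<le> g x) \<Longrightarrow> avg A f \<le> avg A g"
  by (auto simp: avg_def intro!: divide_right_mono sum_mono)

lemma avg_nonneg: "(\<And>x. x \<in> A \<Longrightarrow> 0 \<le> f x) \<Longrightarrow> 0 \<le> avg A f"
  by (auto simp: avg_def intro!: divide_nonneg_nonneg sum_nonneg)

lemma avg_const: "finite A \<Longrightarrow> A \<noteq> {} \<Longrightarrow> avg A (\<lambda>_. c) = c"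
  by (simp add: avg_def)

lemma avg_add: "avg A (\<lambda>x. f x + g x) = avg A f + avg A g"
  by (simp add: avg_def sum.distrib add_divide_distrib)

lemma avg_diff: "avg A (\<lambda>x. f x - g x) = avg A f - avg A g"
  by (simp add: avg_def sum_subtractf diff_divide_distrib)

lemma avg_mult_left: "avg A (\<lambda>x. c * f x) = c * avg A f"
  by (simp add: avg_def sum_distrib_left[symmetric])

lemma avg_mult_right: "avg A (\<lambda>x. f x * c) = avg A f * c"
  by (simp add: avg_def sum_distrib_right[symmetric])

lemma avg_divide: "avg A (\<lambda>x. f x / c) = avg A f / c"
  using avg_mult_right[of A f "inverse c"] by (simp add: field_simps)

lemma avg_sum: "avg A (\<lambda>x. \<Sum>i\<in>I. f i x) = (\<Sum>i\<in>I. avg A (f i))"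
  unfolding avg_def by (subst sum.swap) (simp add: sum_divide_distrib)

lemma avg_swap: "avg A (\<lambda>x. avg B (f x)) = avg B (\<lambda>y. avg A (\<lambda>x. f x y))"
  unfolding avg_def
  by (simp add: sum_divide_distrib[symmetric] sum.swap[of _ B A] mult.commute)

lemma avg_Times: "avg (A \<times> B) f = avg A (\<lambda>x. avg B (\<lambda>y. f (x, y)))"
  using sum.cartesian_product[of "\<lambda>x y. f (x, y)" B A]
  by (simp add: avg_def sum_divide_distrib[symmetric] card_cartesian_product mult.commute)

lemma avg_reindex: "inj_on g A \<Longrightarrow> avg (g ` A) f = avg A (\<lambda>x. f (g x))"
  by (simp add: avg_def sum.reindex card_image)

lemma avg_translate:
  fixes f :: "'g::{finite,ab_group_add} \<Rightarrow> real"
  shows "avg UNIV (\<lambda>a. f (a + d)) = avg UNIV f"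
  using avg_reindex[of "\<lambda>a. a + d" UNIV f] by (simp add: inj_def surj_plus_right)

lemma Cauchy_Schwarz_avg: "(avg A (\<lambda>x. f x * g x))\<^sup>2 \<le> avg A (\<lambda>x. (f x)\<^sup>2) * avg A (\<lambda>x. (g x)\<^sup>2)"
  using Cauchy_Schwarz_ineq_sum[of f g A]
  by (simp add: avg_def power_divide divide_right_mono power2_eq_square)

lemma avg_fiber_pos:
  assumes "finite X" "c \<in> a ` X"
  shows "0 < avg X (\<lambda>x. of_bool (a x = c))"
proof -
  from assms(2) obtain x where x: "x \<in> X" "a x = c" by auto
  have "of_bool (a x = c) \<le> (\<Sum>x\<in>X. of_bool (a x = c) :: real)"
    using x assms(1) by (intro member_le_sum) auto
  moreover have "card X > 0" using x assms(1) by (auto simp: card_gt_0_iff)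
  ultimately show ?thesis using x by (simp add: avg_def)
qed

lemma sum_avg_fibers:
  assumes "finite X" "X \<noteq> {}"
  shows "(\<Sum>c\<in>a ` X. avg X (\<lambda>x. of_bool (a x = c))) = 1"
proof -
  have "(\<Sum>c\<in>a ` X. avg X (\<lambda>x. of_bool (a x = c))) = avg X (\<lambda>x. \<Sum>c\<in>a ` X. of_bool (a x = c))"
    by (simp only: avg_sum)
  also have "\<dots> = avg X (\<lambda>x. 1)"
    by (intro avg_cong) (use assms(1) in \<open>auto simp: of_bool_def\<close>)
  finally show ?thesis using assms by (simp add: avg_const)
qed

lemma words_0 [simp]: "words 0 A = {[]}"
  by (auto simp: words_def)

lemma words_Suc: "words (Suc t) A = (\<lambda>(a, xs). a # xs) ` (A \<times> words t A)"
  by (auto simp: words_def length_Suc_conv image_iff)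

lemma finite_words [simp]: "finite A \<Longrightarrow> finite (words t A)"
  by (simp add: words_def finite_lists_length_eq)

lemma words_nonempty: "A \<noteq> {} \<Longrightarrow> words t A \<noteq> {}"
  by (induction t) (auto simp: words_Suc)

lemma avg_words_Suc: "avg (words (Suc t) A) f = avg A (\<lambda>a. avg (words t A) (\<lambda>xs. f (a # xs)))"
  unfolding words_Suc by (subst avg_reindex) (auto simp: inj_on_def avg_Times)

text \<open>The hypothesis says, through test functions, that \<open>\<phi>\<close> carries the
  uniform law on \<open>Y\<close> to that on \<open>Z\<close>. Letters of a uniform word are
  independent, so peeling off the first letter lifts this to words.\<close>

lemma avg_words_map:
  assumes "\<And>u. avg Y (\<lambda>y. u (\<phi> y)) = avg Z u"
  shows "avg (words t Y) (\<lambda>ys. f (map \<phi> ys)) = avg (words t Z) f"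
proof (induction t arbitrary: f)
  case (Suc t)
  show ?case
    using Suc[of "\<lambda>xs. f (a # xs)" for a] assms[of "\<lambda>a. avg (words t Z) (\<lambda>xs. f (a # xs))"]
    by (simp add: avg_words_Suc)
qed (simp add: avg_def)

text \<open>In a uniform word over a product alphabet the two coordinate words are independent; this
  is Alice's and Bob's joint input in the product case.\<close>

lemma avg_words_Times:
  "avg (words t (A \<times> B)) (\<lambda>zs. f (map fst zs) (map snd zs))
     = avg (words t B) (\<lambda>ys. avg (words t A) (\<lambda>xs. f xs ys))"
proof (induction t arbitrary: f)
  case (Suc t)
  have "avg (words (Suc t) (A \<times> B)) (\<lambda>zs. f (map fst zs) (map snd zs))
     = avg A (\<lambda>a. avg B (\<lambda>b. avg (words t B) (\<lambda>ys. avg (words t A) (\<lambda>xs. f (a # xs) (b # ys)))))"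
    by (simp add: avg_words_Suc avg_Times Suc[of "\<lambda>xs ys. f (a # xs) (b # ys)" for a b])
  also have "\<dots> = avg B (\<lambda>b. avg (words t B) (\<lambda>ys. avg A (\<lambda>a. avg (words t A) (\<lambda>xs. f (a # xs) (b # ys)))))"
    by (simp only: avg_swap[of A])
  finally show ?case by (simp add: avg_words_Suc)
qed (simp add: avg_def)

section \<open>Two-function hypercontractivity\<close>

lemma powr_tangent_quadratic:
  fixes x s L :: real
  assumes "0 \<le> x" "x \<le> L" "1 \<le> L" "0 \<le> s" "s \<le> 1"
  shows "1 + (1 + s) * (x - 1) + s * (1 + s) / (2 * L) * (x - 1)\<^sup>2 \<le> x powr (1 + s)"
proof (cases "x = 0")
  case True
  have "s * (1 + s) / (2 * L) \<le> s * 2 / (2 * 1)"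
    using assms by (intro frac_le mult_left_mono) auto
  with True show ?thesis by simp
next
  case False
  define c where "c = s * (1 + s) / (2 * L)"
  define f where "f = (\<lambda>y::real. y powr (1 + s) - c * (y - 1)\<^sup>2)"
  define f' where "f' = (\<lambda>y::real. (1 + s) * y powr s - 2 * c * (y - 1))"
  define f'' where "f'' = (\<lambda>y::real. (1 + s) * (s * y powr (s - 1)) - 2 * c)"
  have "f' 1 * (x - 1) \<le> f x - f 1"
  proof (rule f''_imp_f'[where C = "{0<..L}" and f'' = f''])
    show "DERIV f y :> f' y" if "y \<in> {0<..L}" for y
      unfolding f_def f'_def using that by (auto intro!: derivative_eq_intros simp: algebra_simps)
    show "DERIV f' y :> f'' y" if "y \<in> {0<..L}" for y
      unfolding f''_def f'_def using that by (auto intro!: derivative_eq_intros simp: algebra_simps)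
    show "0 \<le> f'' y" if y: "y \<in> {0<..L}" for y
    proof -
      have "1 / L \<le> L powr (s - 1)"
        using powr_mono[of "-1" "s - 1" L] assms by (simp add: powr_minus divide_inverse)
      also have "\<dots> \<le> y powr (s - 1)"
        using y assms by (intro powr_mono2') auto
      finally have "(1 + s) * (s * (1 / L)) \<le> (1 + s) * (s * y powr (s - 1))"
        using assms by (intro mult_left_mono) auto
      then show ?thesis using assms by (simp add: f''_def c_def field_simps)
    qed
  qed (use assms False in auto)
  then show ?thesis by (simp add: f_def f'_def c_def)
qed

lemma powr_le_one_plus_mult:
  fixes y r :: real
  assumes "0 \<le> y" "0 \<le> r" "r \<le> 1"
  shows "(1 + y) powr r \<le> 1 + r * y"
  using Youngs_inequality_0[of r "1 - r" "1 + y" 1] assms by (simp add: algebra_simps)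

text \<open>After scaling to mean 1, a nonnegative function on the group is at most
  \<open>CARD('g)\<close>, so the quadratic tangent bound applies pointwise with
  \<open>L = CARD('g)\<close>. Averaging it removes the linear term and leaves the variance.\<close>

lemma hypercontractive_single:
  fixes f :: "'g::finite \<Rightarrow> real"
  assumes f: "\<And>a. 0 \<le> f a" and s: "0 \<le> s" "s \<le> 1"
  shows "(avg UNIV f)\<^sup>2 + s / real CARD('g) * avg UNIV (\<lambda>a. (f a - avg UNIV f)\<^sup>2)
         \<le> (avg UNIV (\<lambda>a. f a powr (1 + s))) powr (2 / (1 + s))"
proof (cases "avg UNIV f = 0")
  case True
  have "f a = 0" for a
    using True f sum_nonneg_eq_0_iff[of UNIV f] by (simp add: avg_def)
  then show ?thesis by (simp add: avg_def)
next
  case False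
  define M where "M = avg UNIV f"
  have M: "M > 0" using False avg_nonneg[of UNIV f] f by (simp add: M_def less_le)
  define L where "L = real CARD('g)"
  have L1: "1 \<le> L" by (simp add: L_def Suc_leI)
  define F where "F a = f a / M" for a
  have fF: "f a = M * F a" for a using M by (simp add: F_def)
  have F0: "0 \<le> F a" for a using f M by (simp add: F_def)
  have FL: "F a \<le> L" for a
  proof -
    have "f a \<le> (\<Sum>a\<in>UNIV. f a)" using f by (intro member_le_sum) auto
    then show ?thesis using M L1 by (simp add: F_def M_def avg_def L_def[symmetric] field_simps)
  qed
  define V where "V = avg UNIV (\<lambda>a. (F a - 1)\<^sup>2)"
  have V0: "0 \<le> V" by (simp add: V_def avg_nonneg)
  have avgF: "avg UNIV F = 1" using M avg_divide[of UNIV f M] by (simp add: F_def[abs_def] M_def[symmetric])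
  have "1 + s * (1 + s) / (2 * L) * V
      = avg UNIV (\<lambda>a. 1 + (1 + s) * (F a - 1) + s * (1 + s) / (2 * L) * (F a - 1)\<^sup>2)"
    by (simp add: avg_add avg_mult_left avg_divide avg_diff avgF avg_const V_def)
  also have "\<dots> \<le> avg UNIV (\<lambda>a. F a powr (1 + s))"
    using F0 FL L1 s by (intro avg_mono powr_tangent_quadratic) auto
  finally have 1: "1 + s * (1 + s) / (2 * L) * V \<le> avg UNIV (\<lambda>a. F a powr (1 + s))" .
  \<comment> \<open>Bernoulli with exponent \<open>(1 + s) / 2\<close>, at most 1: the coefficient
    \<open>s * (1 + s) / (2 * L)\<close> is exactly this exponent times
    \<open>s / L\<close>.\<close>
  have "(1 + s / L * V) powr ((1 + s) / 2) \<le> 1 + (1 + s) / 2 * (s / L * V)"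
    using s L1 V0 by (intro powr_le_one_plus_mult) auto
  also have "\<dots> \<le> avg UNIV (\<lambda>a. F a powr (1 + s))"
    using 1 by (simp add: mult_ac)
  finally have "((1 + s / L * V) powr ((1 + s) / 2)) powr (2 / (1 + s))
      \<le> (avg UNIV (\<lambda>a. F a powr (1 + s))) powr (2 / (1 + s))"
    using s by (intro powr_mono2) auto
  moreover have "((1 + s / L * V) powr ((1 + s) / 2)) powr (2 / (1 + s)) = 1 + s / L * V"
  proof -
    have e: "(1 + s) / 2 * (2 / (1 + s)) = 1" using s by (simp add: field_simps)
    show ?thesis unfolding powr_powr e using s L1 V0 by simp
  qed
  ultimately have 2: "1 + s / L * V \<le> (avg UNIV (\<lambda>a. F a powr (1 + s))) powr (2 / (1 + s))"
    by simp
  have scale: "avg UNIV (\<lambda>a. f a powr (1 + s)) = M powr (1 + s) * avg UNIV (\<lambda>a. F a powr (1 + s))"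
    using M F0 by (simp add: fF powr_mult avg_mult_left)
  have "(avg UNIV (\<lambda>a. f a powr (1 + s))) powr (2 / (1 + s))
      = M\<^sup>2 * (avg UNIV (\<lambda>a. F a powr (1 + s))) powr (2 / (1 + s))"
  proof -
    have e: "(1 + s) * (2 / (1 + s)) = 2" using s by (subst times_divide_eq_right, subst nonzero_mult_div_cancel_left) auto
    have "(M powr (1 + s)) powr (2 / (1 + s)) = M\<^sup>2"
      unfolding powr_powr e using M by (simp add: powr_numeral)
    then show ?thesis using M scale by (simp add: powr_mult avg_nonneg)
  qed
  moreover have "avg UNIV (\<lambda>a. (f a - M)\<^sup>2) = M\<^sup>2 * V"
  proof -
    have "(f a - M)\<^sup>2 = M\<^sup>2 * (F a - 1)\<^sup>2" for a
      by (simp add: fF power2_eq_square algebra_simps)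
    then show ?thesis by (simp add: V_def avg_mult_left)
  qed
  ultimately show ?thesis
    using mult_left_mono[OF 2, of "M\<^sup>2"] by (simp add: M_def[symmetric] L_def[symmetric] algebra_simps)
qed

text \<open>Tensorization: a one-letter bound in \<open>p\<close>-norms passes to words of any
  length without loss, which is why the final bound does not depend on the number of
  samples.\<close>

lemma hypercontractive_words:
  fixes \<phi> \<psi> :: "'y \<Rightarrow> 'g::finite"
  assumes p: "p > 0"
    and base: "\<And>u v. (\<And>a. 0 \<le> u a) \<Longrightarrow> (\<And>a. 0 \<le> v a) \<Longrightarrow>
      avg Y (\<lambda>y. u (\<phi> y) * v (\<psi> y))
        \<le> (avg UNIV (\<lambda>a. u a powr p)) powr (1 / p) * (avg UNIV (\<lambda>a. v a powr p)) powr (1 / p)"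
    and "\<And>x. 0 \<le> f x" "\<And>x. 0 \<le> g x"
  shows "avg (words t Y) (\<lambda>ys. f (map \<phi> ys) * g (map \<psi> ys))
     \<le> (avg (words t UNIV) (\<lambda>x. f x powr p)) powr (1 / p)
       * (avg (words t UNIV) (\<lambda>x. g x powr p)) powr (1 / p)"
  using assms(3,4)
proof (induction t arbitrary: f g)
  case 0
  then show ?case using p by (simp add: avg_def powr_powr)
next
  case (Suc t)
  \<comment> \<open>The \<open>p\<close>-norm of \<open>f\<close> in the remaining letters, as a
    function of the first. The induction hypothesis bounds the inner average by
    \<open>N f * N g\<close>, to which the one-letter bound applies.\<close>
  define N where "N f a = (avg (words t UNIV) (\<lambda>x. f (a # x) powr p)) powr (1 / p)"
    for f :: "'g list \<Rightarrow> real" and a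
  have N_p: "N f a powr p = avg (words t UNIV) (\<lambda>x. f (a # x) powr p)" for f a
    using p by (simp add: N_def powr_powr avg_nonneg)
  have "avg (words (Suc t) Y) (\<lambda>ys. f (map \<phi> ys) * g (map \<psi> ys))
      = avg Y (\<lambda>y. avg (words t Y) (\<lambda>ys. f (\<phi> y # map \<phi> ys) * g (\<psi> y # map \<psi> ys)))"
    by (simp add: avg_words_Suc)
  also have "\<dots> \<le> avg Y (\<lambda>y. N f (\<phi> y) * N g (\<psi> y))"
    unfolding N_def using Suc.prems by (intro avg_mono Suc.IH) auto
  also have "\<dots> \<le> (avg UNIV (\<lambda>a. N f a powr p)) powr (1 / p) * (avg UNIV (\<lambda>a. N g a powr p)) powr (1 / p)"
    by (rule base) (auto simp: N_def)
  finally show ?case by (simp add: N_p avg_words_Suc)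
qed

section \<open>The shift channel\<close>

text \<open>The \<open>l1\<close> distance (without the factor 1/2) between the law of
  \<open>h' i - h i\<close> at a uniform index \<open>i\<close> and the uniform law on the
  group.\<close>

definition shift_bias :: "nat \<Rightarrow> (nat \<Rightarrow> 'g::{finite,ab_group_add}) \<Rightarrow> (nat \<Rightarrow> 'g) \<Rightarrow> real" where
  "shift_bias m h h' =
     (\<Sum>d\<in>UNIV. \<bar>avg {..<m} (\<lambda>i. of_bool (h' i - h i = d)) - 1 / real CARD('g)\<bar>)"

abbreviation bob_letters :: "nat \<Rightarrow> (nat \<times> 'g) set" where
  "bob_letters m \<equiv> {..<m} \<times> UNIV"

definition hidden :: "(nat \<Rightarrow> 'g::ab_group_add) \<Rightarrow> nat \<times> 'g \<Rightarrow> 'g" where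
  "hidden h = (\<lambda>(i, c). c + h i)"

text \<open>At each index the map is a translation of the group, so Alice's marginal is uniform
  whatever \<open>h\<close> is: alone she learns nothing.\<close>

lemma avg_hidden:
  fixes h :: "nat \<Rightarrow> 'g::{finite,ab_group_add}"
  assumes "m > 0"
  shows "avg (bob_letters m) (\<lambda>y. u (hidden h y)) = avg UNIV u"
  using assms by (simp add: avg_Times hidden_def avg_translate avg_const lessThan_empty_iff)

lemma shift_bias_nonneg: "0 \<le> shift_bias m h h'"
  by (auto simp: shift_bias_def intro: sum_nonneg)

text \<open>Averaging over \<open>c\<close> leaves the correlation of \<open>u\<close> and
  \<open>v\<close> at lag \<open>h' i - h i\<close>. Its centred part \<open>R d\<close> sums to 0
  over all lags, so the uniform weight \<open>1 / L\<close> may be subtracted from the empirical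
  weight \<open>w d\<close>; Cauchy-Schwarz then bounds each lag by the standard deviations.\<close>

lemma hidden_correlation:
  fixes h h' :: "nat \<Rightarrow> 'g::{finite,ab_group_add}"
  assumes m: "m > 0"
  shows "avg (bob_letters m) (\<lambda>y. u (hidden h y) * v (hidden h' y))
     \<le> avg UNIV u * avg UNIV v
       + shift_bias m h h' * (sqrt (avg UNIV (\<lambda>a. (u a - avg UNIV u)\<^sup>2))
                              * sqrt (avg UNIV (\<lambda>a. (v a - avg UNIV v)\<^sup>2)))"
proof -
  define w where "w d = avg {..<m} (\<lambda>i. of_bool (h' i - h i = d))" for d
  define L where "L = real CARD('g)"
  have L: "L > 0" by (simp add: L_def)
  define U where "U a = u a - avg UNIV u" for a
  define V where "V a = v a - avg UNIV v" for a
  define R where "R d = avg UNIV (\<lambda>a. U a * V (a + d))" for d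
  define B where "B = sqrt (avg UNIV (\<lambda>a. (U a)\<^sup>2)) * sqrt (avg UNIV (\<lambda>a. (V a)\<^sup>2))"
  have avgU: "avg UNIV U = 0" and avgV: "avg UNIV V = 0"
    by (simp_all add: U_def[abs_def] V_def[abs_def] avg_diff avg_const)
  have C: "avg UNIV (\<lambda>a. u a * v (a + d)) = avg UNIV u * avg UNIV v + R d" for d
  proof -
    have "u a * v (a + d) = avg UNIV u * avg UNIV v + avg UNIV u * V (a + d) + U a * avg UNIV v
        + U a * V (a + d)" for a
      by (simp add: U_def V_def algebra_simps)
    then show ?thesis
      by (simp add: avg_add avg_mult_left avg_mult_right avg_const avg_translate avgU avgV R_def)
  qed
  have R_le: "\<bar>R d\<bar> \<le> B" for d
  proof -
    have "(R d)\<^sup>2 \<le> avg UNIV (\<lambda>a. (U a)\<^sup>2) * avg UNIV (\<lambda>a. (V (a + d))\<^sup>2)"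
      unfolding R_def by (rule Cauchy_Schwarz_avg)
    also have "\<dots> = B\<^sup>2"
      using avg_translate[of "\<lambda>a. (V a)\<^sup>2" d] by (simp add: B_def power_mult_distrib avg_nonneg)
    finally have "\<bar>R d\<bar> \<le> \<bar>B\<bar>" by (simp add: abs_le_square_iff)
    then show ?thesis by (simp add: B_def avg_nonneg)
  qed
  have "(\<Sum>d\<in>UNIV. R d) = avg UNIV (\<lambda>a. \<Sum>d\<in>UNIV. U a * V (a + d))"
    by (simp add: R_def avg_sum)
  also have "\<dots> = avg UNIV (\<lambda>a. U a * (L * avg UNIV (\<lambda>d. V (d + a))))"
    by (intro avg_cong) (simp add: L_def avg_def sum_distrib_left[symmetric] add.commute)
  finally have sumR: "(\<Sum>d\<in>UNIV. R d) = 0"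
    by (simp add: avg_translate avgV avg_const)
  have shift: "avg UNIV (\<lambda>c. u (c + h i) * v (c + h' i)) = avg UNIV u * avg UNIV v + R (h' i - h i)" for i
    using avg_translate[of "\<lambda>c. u c * v (c + (h' i - h i))" "h i"] C[of "h' i - h i"]
    by (simp add: algebra_simps)
  have R_expand: "R e = (\<Sum>d\<in>UNIV. of_bool (e = d) * R d)" for e
    by (simp add: of_bool_def if_distrib[of "\<lambda>x. x * _"] cong: if_cong)
  have "avg {..<m} (\<lambda>i. R (h' i - h i)) = avg {..<m} (\<lambda>i. \<Sum>d\<in>UNIV. of_bool (h' i - h i = d) * R d)"
    by (intro avg_cong R_expand)
  also have "\<dots> = (\<Sum>d\<in>UNIV. w d * R d)"
    by (simp only: avg_sum avg_mult_right w_def)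
  also have "\<dots> = (\<Sum>d\<in>UNIV. (w d - 1 / L) * R d)"
    using sumR by (simp add: left_diff_distrib sum_subtractf sum_divide_distrib[symmetric])
  also have "\<dots> \<le> (\<Sum>d\<in>UNIV. \<bar>w d - 1 / L\<bar> * B)"
  proof (intro sum_mono)
    fix d
    have "(w d - 1 / L) * R d \<le> \<bar>w d - 1 / L\<bar> * \<bar>R d\<bar>"
      using abs_ge_self[of "(w d - 1 / L) * R d"] by (simp add: abs_mult)
    also have "\<dots> \<le> \<bar>w d - 1 / L\<bar> * B" using R_le by (intro mult_left_mono) auto
    finally show "(w d - 1 / L) * R d \<le> \<bar>w d - 1 / L\<bar> * B" .
  qed
  also have "\<dots> = shift_bias m h h' * B"
    by (simp add: shift_bias_def w_def L_def sum_distrib_right)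
  finally have "avg {..<m} (\<lambda>i. R (h' i - h i)) \<le> shift_bias m h h' * B" .
  then show ?thesis
    using m by (simp add: avg_Times hidden_def shift avg_add avg_const lessThan_empty_iff B_def U_def V_def)
qed

text \<open>The exponent is chosen so that \<open>s / CARD('g)\<close> is the shift bias
  \<open>\<delta>\<close>. A planar Cauchy-Schwarz splits the correlation bound into two factors
  \<open>sqrt (mean^2 + \<delta> * var)\<close>, each controlled by
  \<open>hypercontractive_single\<close>.\<close>

lemma hypercontractive_letter:
  fixes h h' :: "nat \<Rightarrow> 'g::{finite,ab_group_add}"
  assumes m: "m > 0"
    and u: "\<And>a. 0 \<le> u a" and v: "\<And>a. 0 \<le> v a"
    and s: "s = real CARD('g) * shift_bias m h h'" "s \<le> 1"
  shows "avg (bob_letters m) (\<lambda>y. u (hidden h y) * v (hidden h' y))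
     \<le> (avg UNIV (\<lambda>a. u a powr (1 + s))) powr (1 / (1 + s))
       * (avg UNIV (\<lambda>a. v a powr (1 + s))) powr (1 / (1 + s))"
proof -
  define \<delta> where "\<delta> = shift_bias m h h'"
  have \<delta>0: "0 \<le> \<delta>" by (simp add: \<delta>_def shift_bias_nonneg)
  have s0: "0 \<le> s" using \<delta>0 by (simp add: s \<delta>_def)
  define var where "var u = avg UNIV (\<lambda>a. (u a - avg UNIV u)\<^sup>2)" for u :: "'g \<Rightarrow> real"
  have var0: "0 \<le> var u" for u by (simp add: var_def avg_nonneg)
  have single: "sqrt ((avg UNIV u)\<^sup>2 + \<delta> * var u) \<le> (avg UNIV (\<lambda>a. u a powr (1 + s))) powr (1 / (1 + s))"
    if "\<And>a. 0 \<le> u a" for u :: "'g \<Rightarrow> real"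
  proof -
    have "(avg UNIV u)\<^sup>2 + \<delta> * var u \<le> (avg UNIV (\<lambda>a. u a powr (1 + s))) powr (2 / (1 + s))"
      using hypercontractive_single[of u s, OF that s0 s(2)] by (simp add: s \<delta>_def var_def)
    also have "\<dots> = ((avg UNIV (\<lambda>a. u a powr (1 + s))) powr (1 / (1 + s)))\<^sup>2"
      by (simp add: power2_eq_square powr_add[symmetric] add_divide_distrib[symmetric])
    finally show ?thesis by (simp add: real_le_lsqrt)
  qed
  have "(avg UNIV u * avg UNIV v + sqrt (\<delta> * var u) * sqrt (\<delta> * var v))\<^sup>2
      \<le> ((avg UNIV u)\<^sup>2 + (sqrt (\<delta> * var u))\<^sup>2) * ((avg UNIV v)\<^sup>2 + (sqrt (\<delta> * var v))\<^sup>2)"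
    using sum_squares_bound[of "avg UNIV u * sqrt (\<delta> * var v)" "avg UNIV v * sqrt (\<delta> * var u)"]
    by (simp add: power2_eq_square algebra_simps)
  also have "\<dots> = ((avg UNIV u)\<^sup>2 + \<delta> * var u) * ((avg UNIV v)\<^sup>2 + \<delta> * var v)"
    using \<delta>0 var0 by simp
  finally have CS: "avg UNIV u * avg UNIV v + sqrt (\<delta> * var u) * sqrt (\<delta> * var v)
      \<le> sqrt ((avg UNIV u)\<^sup>2 + \<delta> * var u) * sqrt ((avg UNIV v)\<^sup>2 + \<delta> * var v)"
    by (metis real_le_rsqrt real_sqrt_mult)
  have "sqrt (\<delta> * var u) * sqrt (\<delta> * var v) = \<delta> * (sqrt (var u) * sqrt (var v))"
    using \<delta>0 by (simp add: real_sqrt_mult)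
  then have "avg (bob_letters m) (\<lambda>y. u (hidden h y) * v (hidden h' y))
      \<le> avg UNIV u * avg UNIV v + sqrt (\<delta> * var u) * sqrt (\<delta> * var v)"
    using hidden_correlation[OF m, of u h v h'] by (simp add: \<delta>_def var_def)
  also note CS
  also have "sqrt ((avg UNIV u)\<^sup>2 + \<delta> * var u) * sqrt ((avg UNIV v)\<^sup>2 + \<delta> * var v)
      \<le> (avg UNIV (\<lambda>a. u a powr (1 + s))) powr (1 / (1 + s))
       * (avg UNIV (\<lambda>a. v a powr (1 + s))) powr (1 / (1 + s))"
    using \<delta>0 var0 u v by (intro mult_mono single) auto
  finally show ?thesis .
qed

text \<open>The indicator of \<open>A\<close> is its own power, so each of the two norms equals
  \<open>r powr (1 / (1 + s))\<close>.\<close>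

lemma small_set_expansion:
  fixes h h' :: "nat \<Rightarrow> 'g::{finite,ab_group_add}"
  assumes m: "m > 0" and s: "s = real CARD('g) * shift_bias m h h'" "s \<le> 1"
    and r: "r = avg (words t UNIV) (\<lambda>x. of_bool (x \<in> A))"
  shows "avg (words t (bob_letters m)) (\<lambda>ys. of_bool (map (hidden h) ys \<in> A) * of_bool (map (hidden h') ys \<in> A))
     \<le> r powr (2 / (1 + s))"
proof -
  have s0: "0 \<le> s" by (simp add: s shift_bias_nonneg)
  have "avg (words t (bob_letters m)) (\<lambda>ys. of_bool (map (hidden h) ys \<in> A) * of_bool (map (hidden h') ys \<in> A))
    \<le> (avg (words t UNIV) (\<lambda>x::'g list. of_bool (x \<in> A) powr (1 + s))) powr (1 / (1 + s))
     * (avg (words t UNIV) (\<lambda>x::'g list. of_bool (x \<in> A) powr (1 + s))) powr (1 / (1 + s))"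
    using s0 by (intro hypercontractive_words hypercontractive_letter m s) auto
  also have "(\<lambda>x::'g list. of_bool (x \<in> A) powr (1 + s)) = (\<lambda>x. of_bool (x \<in> A))"
    by (auto simp: of_bool_def)
  finally show ?thesis
    by (simp add: r powr_add[symmetric] add_divide_distrib[symmetric])
qed

text \<open>The uniform distribution is the extreme case. Weighted AM-GM of each \<open>r x\<close>
  against \<open>1 / card M\<close> gives the bound.\<close>

lemma sum_powr_le_card_powr:
  assumes M: "finite M" "M \<noteq> {}" and r: "\<And>x. x \<in> M \<Longrightarrow> 0 < r x" "(\<Sum>x\<in>M. r x) = 1"
    and \<theta>: "0 \<le> \<theta>" "\<theta> \<le> 1"
  shows "(\<Sum>x\<in>M. r x powr (1 - \<theta>)) \<le> real (card M) powr \<theta>"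
proof -
  define N where "N = real (card M)"
  have N: "N > 0" using M by (simp add: N_def card_gt_0_iff)
  have "(\<Sum>x\<in>M. r x powr (1 - \<theta>) * (1 / N) powr \<theta>) \<le> (\<Sum>x\<in>M. (1 - \<theta>) * r x + \<theta> * (1 / N))"
    using r N \<theta> by (intro sum_mono Youngs_inequality_0) auto
  also have "\<dots> = 1"
    using N r by (simp add: sum.distrib sum_distrib_left[symmetric] N_def[symmetric])
  finally show ?thesis
    using N by (simp add: sum_distrib_right[symmetric] sum_divide_distrib[symmetric] powr_divide N_def[symmetric] field_simps)
qed

section \<open>The advantage of a deterministic protocol\<close>

text \<open>\<open>K c\<close> is the probability that \<open>h\<close> and \<open>h'\<close>,
  applied to the same uniform Bob word, both lead Alice to send \<open>c\<close>. For
  \<open>s \<le> 1\<close> small-set expansion bounds it; for larger \<open>s\<close> the trivial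
  \<open>K c \<le> r c\<close> gives \<open>card M\<close>, already below the claim.\<close>

lemma sum_ratio_le_card_powr:
  fixes h h' :: "nat \<Rightarrow> 'g::{finite,ab_group_add}" and a :: "'g list \<Rightarrow> 'msg" and t :: nat
  assumes m: "m > 0"
  defines "r \<equiv> \<lambda>c. avg (words t UNIV) (\<lambda>x. of_bool (a x = c))"
    and "K \<equiv> \<lambda>c. avg (words t (bob_letters m))
                (\<lambda>ys. of_bool (a (map (hidden h) ys) = c) * of_bool (a (map (hidden h') ys) = c))"
    and "M \<equiv> a ` words t UNIV"
  shows "(\<Sum>c\<in>M. K c / r c) \<le> real (card M) powr (2 * real CARD('g) * shift_bias m h h')"
proof -
  define s where "s = real CARD('g) * shift_bias m h h'"
  have s0: "0 \<le> s" by (simp add: s_def shift_bias_nonneg)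
  have M: "finite M" "M \<noteq> {}" by (simp_all add: M_def words_nonempty)
  then have card1: "1 \<le> real (card M)" by (simp add: Suc_leI card_gt_0_iff)
  have rpos: "0 < r c" if "c \<in> M" for c
    using that unfolding r_def M_def by (intro avg_fiber_pos) simp_all
  have rsum: "(\<Sum>c\<in>M. r c) = 1"
    unfolding r_def M_def by (intro sum_avg_fibers) (simp_all add: words_nonempty)
  show ?thesis
  proof (cases "s \<le> 1")
    case True
    \<comment> \<open>Chosen so that \<open>2 / (1 + s) = 2 - \<theta>\<close>; one factor
      \<open>r c\<close> cancels the denominator.\<close>
    define \<theta> where "\<theta> = 2 * s / (1 + s)"
    have \<theta>: "0 \<le> \<theta>" "\<theta> \<le> 1" "\<theta> \<le> 2 * s"
      using s0 True by (auto simp: \<theta>_def field_simps)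
    have "K c / r c \<le> r c powr (1 - \<theta>)" if "c \<in> M" for c
    proof -
      have "K c \<le> r c powr (2 / (1 + s))"
        using small_set_expansion[OF m s_def True, of "r c" t "{x. a x = c}"] by (simp add: K_def r_def)
      also have "2 / (1 + s) = 1 + (1 - \<theta>)" using s0 by (simp add: \<theta>_def field_simps)
      also have "r c powr (1 + (1 - \<theta>)) = r c * r c powr (1 - \<theta>)"
        unfolding powr_add using rpos[OF that] by simp
      finally show ?thesis using rpos[OF that] by (simp add: divide_le_eq mult.commute)
    qed
    then have "(\<Sum>c\<in>M. K c / r c) \<le> (\<Sum>c\<in>M. r c powr (1 - \<theta>))" by (intro sum_mono)
    also have "\<dots> \<le> real (card M) powr \<theta>"
      by (intro sum_powr_le_card_powr M rpos rsum \<theta>)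
    also have "\<dots> \<le> real (card M) powr (2 * s)" using card1 \<theta> by (intro powr_mono) auto
    finally show ?thesis by (simp add: s_def mult.assoc)
  next
    case False
    have "K c \<le> r c" for c
    proof -
      have "K c \<le> avg (words t (bob_letters m)) (\<lambda>ys. of_bool (a (map (hidden h) ys) = c))"
        unfolding K_def by (intro avg_mono) auto
      also have "\<dots> = r c"
        unfolding r_def by (intro avg_words_map[of _ _ _ _ "\<lambda>x. of_bool (a x = c)"] avg_hidden m)
      finally show ?thesis .
    qed
    then have "(\<Sum>c\<in>M. K c / r c) \<le> (\<Sum>c\<in>M. 1)" using rpos by (intro sum_mono) (simp add: divide_le_eq_1)
    also have "\<dots> \<le> real (card M) powr (2 * s)"
      using powr_mono[of 1 "2 * s" "real (card M)"] card1 False by simp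
    finally show ?thesis by (simp add: s_def mult.assoc)
  qed
qed

lemma advantage_le:
  fixes a :: "'g::{finite,ab_group_add} list \<Rightarrow> 'msg" and b :: "'msg \<Rightarrow> (nat \<times> 'g) list \<Rightarrow> real"
    and H :: "(nat \<Rightarrow> 'g) set"
  assumes m: "m > 0" and H: "finite H" "H \<noteq> {}"
    and b: "\<And>c y. 0 \<le> b c y" "\<And>c y. b c y \<le> 1"
  shows "(avg H (\<lambda>h. avg (words t (bob_letters m)) (\<lambda>ys. b (a (map (hidden h) ys)) ys))
        - avg (words t (bob_letters m)) (\<lambda>ys. avg (words t UNIV) (\<lambda>x. b (a x) ys)))\<^sup>2
     \<le> avg H (\<lambda>h. avg H (\<lambda>h'.
          real (card (a ` words t UNIV)) powr (2 * real CARD('g) * shift_bias m h h'))) - 1"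
    (is "(?no - ?yes)\<^sup>2 \<le> ?rhs")
proof -
  let ?X = "words t (UNIV :: 'g set)"
  let ?Y = "words t (bob_letters m) :: (nat \<times> 'g) list set"
  define M where "M = a ` ?X"
  define r where "r c = avg ?X (\<lambda>x. of_bool (a x = c))" for c
  \<comment> \<open>The probability, over random \<open>h\<close>, that message \<open>c\<close> is
    sent when Bob holds \<open>ys\<close>. Its mean over \<open>ys\<close> is \<open>r c\<close>, so
    Bob's advantage comes only from the fluctuation of \<open>Q c\<close>.\<close>
  define Q where "Q c ys = avg H (\<lambda>h. of_bool (a (map (hidden h) ys) = c))" for c ys
  define d where "d c = avg ?Y (\<lambda>ys. b c ys * (Q c ys - r c))" for c
  have M: "finite M" "M \<noteq> {}" by (simp_all add: M_def words_nonempty)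
  have Y: "finite ?Y" "?Y \<noteq> {}" using m by (auto simp: words_nonempty lessThan_empty_iff)
  have split: "b (a x) ys = (\<Sum>c\<in>M. b c ys * of_bool (a x = c))" if "x \<in> ?X" for x ys
    using M that by (simp add: M_def of_bool_def if_distrib cong: if_cong)
  have in_X: "map (hidden h) ys \<in> ?X" if "ys \<in> ?Y" for h ys
    using that by (simp add: words_def)
  have rpos: "0 < r c" if "c \<in> M" for c
    using that unfolding r_def M_def by (intro avg_fiber_pos) simp_all
  have rsum: "(\<Sum>c\<in>M. r c) = 1"
    unfolding r_def M_def by (intro sum_avg_fibers) (simp_all add: words_nonempty)
  have "?no = avg ?Y (\<lambda>ys. avg H (\<lambda>h. b (a (map (hidden h) ys)) ys))"
    by (rule avg_swap)
  also have "\<dots> = avg ?Y (\<lambda>ys. avg H (\<lambda>h. \<Sum>c\<in>M. b c ys * of_bool (a (map (hidden h) ys) = c)))"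
    by (intro avg_cong split in_X)
  finally have no: "?no = avg ?Y (\<lambda>ys. \<Sum>c\<in>M. b c ys * Q c ys)"
    by (simp only: avg_sum avg_mult_left Q_def)
  have "?yes = avg ?Y (\<lambda>ys. avg ?X (\<lambda>x. \<Sum>c\<in>M. b c ys * of_bool (a x = c)))"
    by (intro avg_cong split)
  then have yes: "?yes = avg ?Y (\<lambda>ys. \<Sum>c\<in>M. b c ys * r c)"
    by (simp only: avg_sum avg_mult_left r_def)
  have diff: "?no - ?yes = (\<Sum>c\<in>M. d c)"
    unfolding no yes d_def by (simp only: avg_diff[symmetric] sum_subtractf[symmetric]
        right_diff_distrib[symmetric] avg_sum)
  have d_sq: "(d c)\<^sup>2 \<le> avg ?Y (\<lambda>ys. (Q c ys)\<^sup>2) - (r c)\<^sup>2" for c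
  proof -
    have "avg ?Y (Q c) = avg H (\<lambda>h. avg ?Y (\<lambda>ys. of_bool (a (map (hidden h) ys) = c)))"
      unfolding Q_def by (rule avg_swap)
    also have "\<dots> = avg H (\<lambda>h. r c)"
      unfolding r_def by (intro avg_cong avg_words_map[of _ _ _ _ "\<lambda>x. of_bool (a x = c)"] avg_hidden m)
    finally have Qr: "avg ?Y (Q c) = r c" using H by (simp add: avg_const)
    have "(d c)\<^sup>2 \<le> avg ?Y (\<lambda>ys. (b c ys)\<^sup>2) * avg ?Y (\<lambda>ys. (Q c ys - r c)\<^sup>2)"
      unfolding d_def by (rule Cauchy_Schwarz_avg)
    also have "\<dots> \<le> avg ?Y (\<lambda>ys. 1) * avg ?Y (\<lambda>ys. (Q c ys - r c)\<^sup>2)"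
      using b by (intro mult_right_mono avg_mono avg_nonneg) (auto simp: power_le_one)
    also have "\<dots> = avg ?Y (\<lambda>ys. (Q c ys)\<^sup>2 + (r c)\<^sup>2 - 2 * r c * Q c ys)"
      using Y by (simp add: avg_const power2_diff mult_ac)
    also have "\<dots> = avg ?Y (\<lambda>ys. (Q c ys)\<^sup>2) - (r c)\<^sup>2"
      using Y by (simp add: avg_diff avg_add avg_mult_left avg_const Qr power2_eq_square)
    finally show ?thesis .
  qed
  define K where "K h h' c = avg ?Y
     (\<lambda>ys. of_bool (a (map (hidden h) ys) = c) * of_bool (a (map (hidden h') ys) = c))" for h h' c
  \<comment> \<open>Squaring an average over \<open>h\<close> introduces an independent second copy
    \<open>h'\<close>.\<close>
  have Q_sq: "avg ?Y (\<lambda>ys. (Q c ys)\<^sup>2) = avg H (\<lambda>h. avg H (\<lambda>h'. K h h' c))" for c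
  proof -
    have "avg ?Y (\<lambda>ys. (Q c ys)\<^sup>2)
        = avg ?Y (\<lambda>ys. avg H (\<lambda>h. avg H (\<lambda>h'. of_bool (a (map (hidden h) ys) = c) * of_bool (a (map (hidden h') ys) = c))))"
      unfolding power2_eq_square avg_mult_left avg_mult_right Q_def ..
    also have "\<dots> = avg H (\<lambda>h. avg H (\<lambda>h'. K h h' c))"
      unfolding K_def by (subst avg_swap) (subst avg_swap[of ?Y], rule refl)
    finally show ?thesis .
  qed
  \<comment> \<open>Cauchy-Schwarz over messages with weights \<open>r c\<close>, which sum to 1.
    This divides each variance by \<open>r c\<close>, and the subtracted squares of the means add up
    to the final \<open>- 1\<close>.\<close>
  have "(?no - ?yes)\<^sup>2 = (\<Sum>c\<in>M. sqrt (r c) * (d c / sqrt (r c)))\<^sup>2"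
    unfolding diff by (intro arg_cong[where f = "\<lambda>x. x\<^sup>2"] sum.cong) (auto dest: rpos)
  also have "\<dots> \<le> (\<Sum>c\<in>M. (sqrt (r c))\<^sup>2) * (\<Sum>c\<in>M. (d c / sqrt (r c))\<^sup>2)"
    by (rule Cauchy_Schwarz_ineq_sum)
  also have "(\<Sum>c\<in>M. (sqrt (r c))\<^sup>2) = 1"
    unfolding rsum[symmetric] by (intro sum.cong) (auto dest: rpos)
  also have "1 * (\<Sum>c\<in>M. (d c / sqrt (r c))\<^sup>2) \<le> (\<Sum>c\<in>M. avg ?Y (\<lambda>ys. (Q c ys)\<^sup>2) / r c - r c)"
  proof (simp, intro sum_mono)
    fix c assume c: "c \<in> M"
    have "(d c / sqrt (r c))\<^sup>2 = (d c)\<^sup>2 / r c" using rpos[OF c] by (simp add: power_divide)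
    also have "\<dots> \<le> (avg ?Y (\<lambda>ys. (Q c ys)\<^sup>2) - (r c)\<^sup>2) / r c"
      using rpos[OF c] d_sq by (intro divide_right_mono) auto
    also have "\<dots> = avg ?Y (\<lambda>ys. (Q c ys)\<^sup>2) / r c - r c"
      using rpos[OF c] by (simp add: diff_divide_distrib power2_eq_square)
    finally show "(d c / sqrt (r c))\<^sup>2 \<le> avg ?Y (\<lambda>ys. (Q c ys)\<^sup>2) / r c - r c" .
  qed
  also have "\<dots> = avg H (\<lambda>h. avg H (\<lambda>h'. \<Sum>c\<in>M. K h h' c / r c)) - 1"
    by (simp add: sum_subtractf rsum Q_sq avg_sum avg_divide)
  also have "avg H (\<lambda>h. avg H (\<lambda>h'. \<Sum>c\<in>M. K h h' c / r c))
     \<le> avg H (\<lambda>h. avg H (\<lambda>h'. real (card M) powr (2 * real CARD('g) * shift_bias m h h')))"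
    unfolding K_def r_def M_def by (intro avg_mono sum_ratio_le_card_powr m)
  finally show ?thesis by (simp add: M_def)
qed

section \<open>Concentration of the shift bias\<close>

text \<open>For negative \<open>y = - z\<close>, the Taylor lower bound for \<open>exp z\<close>
  times \<open>1 - z + z\<^sup>2\<close> is at least 1, which bounds the reciprocal.\<close>

lemma exp_le_quadratic:
  fixes y :: real
  assumes "\<bar>y\<bar> \<le> 1"
  shows "exp y \<le> 1 + y + y\<^sup>2"
proof (cases "0 \<le> y")
  case True
  then show ?thesis using assms by (intro exp_bound) auto
next
  case False
  define z where "z = - y"
  have z: "0 \<le> z" "z \<le> 1" using False assms by (auto simp: z_def)
  have "1 \<le> (1 + z + z\<^sup>2 / 2) * (1 - z + z\<^sup>2)"
  proof -
    have "(1 + z + z\<^sup>2 / 2) * (1 - z + z\<^sup>2) = 1 + (z\<^sup>2 + z ^ 3 + z ^ 4) / 2"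
      by (simp add: power2_eq_square power3_eq_cube power4_eq_xxxx field_simps)
    then show ?thesis using z by simp
  qed
  also have "\<dots> \<le> exp z * (1 - z + z\<^sup>2)"
    using z exp_lower_Taylor_quadratic[of z] by (intro mult_right_mono) auto
  finally have "exp (- z) \<le> 1 - z + z\<^sup>2" by (simp add: exp_minus field_simps)
  then show ?thesis by (simp add: z_def)
qed

text \<open>Functions fixed to \<open>undefined\<close> from \<open>m\<close> on, so that the set is
  finite; a uniform member has independent uniform values below \<open>m\<close>.\<close>

definition shifts :: "nat \<Rightarrow> (nat \<Rightarrow> 'g) set" where
  "shifts m = PiE {..<m} (\<lambda>_. UNIV)"

lemma finite_shifts [simp]: "finite (shifts m :: (nat \<Rightarrow> 'g::finite) set)"
  and shifts_nonempty [simp]: "shifts m \<noteq> {}"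
  by (auto simp: shifts_def PiE_eq_empty_iff intro: finite_PiE)

lemma avg_shifts_prod:
  "avg (shifts m) (\<lambda>h. \<Prod>i<m. f i (h i)) = (\<Prod>i<m. avg (UNIV :: 'g::finite set) (f i))"
  using prod_sum_PiE[of "{..<m}" "\<lambda>_. UNIV :: 'g set" f]
  by (simp add: avg_def shifts_def card_PiE prod_dividef)

text \<open>A Chernoff-type moment bound. The variable \<open>\<zeta>\<close> has mean 0 and mean
  square \<open>L - 1\<close>; the lower bound on \<open>m\<close> keeps its scaled value within
  \<open>[-1, 1]\<close>, where \<open>exp\<close> is at most quadratic. Each letter contributes at
  most \<open>exp (L / m)\<close>. Both signs \<open>\<sigma>\<close> serve for the two
  tails.\<close>

lemma exp_moment_count:
  fixes h :: "nat \<Rightarrow> 'g::{finite,ab_group_add}" and d :: 'g and \<sigma> :: real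
  assumes m: "real m \<ge> (real CARD('g))\<^sup>2" and \<sigma>: "\<bar>\<sigma>\<bar> = 1"
  shows "avg (shifts m) (\<lambda>h'. exp (\<sigma> * (\<Sum>i<m. (real CARD('g) * of_bool (h' i - h i = d) - 1) / sqrt (real m))))
     \<le> exp (real CARD('g))"
proof -
  define L where "L = real CARD('g)"
  have L: "1 \<le> L" by (simp add: L_def Suc_leI)
  have m0: "real m > 0" using m one_le_power[OF L, of 2] unfolding L_def by linarith
  have \<sigma>2: "\<sigma>\<^sup>2 = 1" using \<sigma> by (metis power2_abs one_power2)
  have Lm: "L \<le> sqrt (real m)" using m by (simp add: L_def real_le_rsqrt)
  define \<zeta> where "\<zeta> c = L * of_bool (c = d) - 1" for c :: 'g
  have \<zeta>1: "avg UNIV \<zeta> = 0"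
    using L by (simp add: \<zeta>_def[abs_def] avg_diff avg_mult_left avg_const) (simp add: avg_def L_def of_bool_def)
  have "avg UNIV (\<lambda>c. (\<zeta> c)\<^sup>2) = avg UNIV (\<lambda>c. (L - 2) * (L * of_bool (c = d)) + 1)"
    by (intro avg_cong) (simp add: \<zeta>_def power2_eq_square algebra_simps)
  also have "\<dots> = L - 1"
    using L by (simp add: avg_add avg_mult_left avg_const) (simp add: avg_def L_def of_bool_def)
  finally have \<zeta>2: "avg UNIV (\<lambda>c. (\<zeta> c)\<^sup>2) = L - 1" .
  have letter: "avg UNIV (\<lambda>c. exp (\<sigma> * (\<zeta> (c - b) / sqrt (real m)))) \<le> exp (L / real m)" for b
  proof -
    have "avg UNIV (\<lambda>c. exp (\<sigma> * (\<zeta> (c - b) / sqrt (real m)))) = avg UNIV (\<lambda>c. exp (\<sigma> * (\<zeta> c / sqrt (real m))))"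
      using avg_translate[of "\<lambda>c. exp (\<sigma> * (\<zeta> c / sqrt (real m)))" "- b"] by simp
    also have "\<dots> \<le> avg UNIV (\<lambda>c. 1 + \<sigma> / sqrt (real m) * \<zeta> c + (\<zeta> c)\<^sup>2 / real m)"
    proof (intro avg_mono)
      fix c
      have "\<bar>\<zeta> c\<bar> \<le> sqrt (real m)" using L Lm m0 by (auto simp: \<zeta>_def of_bool_def)
      then have "\<bar>\<sigma> * (\<zeta> c / sqrt (real m))\<bar> \<le> 1"
        using \<sigma> m0 by (simp add: abs_mult abs_divide)
      from exp_le_quadratic[OF this]
      show "exp (\<sigma> * (\<zeta> c / sqrt (real m))) \<le> 1 + \<sigma> / sqrt (real m) * \<zeta> c + (\<zeta> c)\<^sup>2 / real m"
        using \<sigma>2 by (simp add: power_mult_distrib power_divide)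
    qed
    also have "\<dots> = 1 + (L - 1) / real m"
      by (simp add: avg_add avg_mult_left avg_divide avg_const \<zeta>1 \<zeta>2)
    also have "\<dots> \<le> exp ((L - 1) / real m)" by (rule exp_ge_add_one_self)
    also have "\<dots> \<le> exp (L / real m)" using m0 by (simp add: divide_right_mono)
    finally show ?thesis .
  qed
  have "avg (shifts m) (\<lambda>h'. exp (\<sigma> * (\<Sum>i<m. (L * of_bool (h' i - h i = d) - 1) / sqrt (real m))))
      = avg (shifts m) (\<lambda>h'. \<Prod>i<m. exp (\<sigma> * (\<zeta> (h' i - h i) / sqrt (real m))))"
    by (intro avg_cong) (simp add: sum_distrib_left exp_sum \<zeta>_def)
  also have "\<dots> = (\<Prod>i<m. avg UNIV (\<lambda>c. exp (\<sigma> * (\<zeta> (c - h i) / sqrt (real m)))))"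
    by (rule avg_shifts_prod)
  also have "\<dots> \<le> (\<Prod>i<m. exp (L / real m))"
    by (intro prod_mono conjI letter avg_nonneg) auto
  also have "\<dots> = exp L" using m0 by (simp add: exp_of_nat_mult[symmetric])
  finally show ?thesis by (simp add: L_def)
qed

text \<open>The scaled bias is the average over \<open>d\<close> of
  \<open>\<bar>S h' d\<bar>\<close>. Jensen moves \<open>exp\<close> inside, and the exponential of
  an absolute value is at most the sum over both signs.\<close>

lemma exp_moment_shift_bias:
  fixes h :: "nat \<Rightarrow> 'g::{finite,ab_group_add}"
  assumes m: "real m \<ge> (real CARD('g))\<^sup>2"
  shows "avg (shifts m) (\<lambda>h'. exp (sqrt (real m) * shift_bias m h h')) \<le> 2 * exp (real CARD('g))"
proof -
  define L where "L = real CARD('g)"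
  have L: "1 \<le> L" by (simp add: L_def Suc_leI)
  have m0: "real m > 0" using m one_le_power[OF L, of 2] unfolding L_def by linarith
  define S where "S h' d = (\<Sum>i<m. (L * of_bool (h' i - h i = d) - 1) / sqrt (real m))" for h' d
  have bias: "sqrt (real m) * shift_bias m h h' = avg UNIV (\<lambda>d. \<bar>S h' d\<bar>)" for h'
  proof -
    have "S h' d = sqrt (real m) * L * (avg {..<m} (\<lambda>i. of_bool (h' i - h i = d)) - 1 / L)" for d
    proof -
      have "S h' d = (L * (\<Sum>i<m. of_bool (h' i - h i = d)) - real m) / sqrt (real m)"
        by (simp add: S_def sum_divide_distrib[symmetric] sum_subtractf sum_distrib_left[symmetric])
      also have "\<dots> = sqrt (real m) * L * ((\<Sum>i<m. of_bool (h' i - h i = d)) / real m - 1 / L)"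
      proof -
        have eq: "(L * x - R * R) / R = R * L * (x / (R * R) - 1 / L)" if "R > 0" for x R :: real
          using that L by (simp add: field_simps)
        show ?thesis using eq[of "sqrt (real m)"] m0 by simp
      qed
      finally show ?thesis by (simp add: avg_def)
    qed
    then show ?thesis
      using L by (simp add: shift_bias_def avg_def abs_mult L_def[symmetric] sum_distrib_left[symmetric])
  qed
  have "avg (shifts m) (\<lambda>h'. exp (sqrt (real m) * shift_bias m h h'))
      \<le> avg (shifts m) (\<lambda>h'. avg UNIV (\<lambda>d. exp (S h' d) + exp (- S h' d)))"
  proof (intro avg_mono)
    fix h' :: "nat \<Rightarrow> 'g"
    have "exp (avg UNIV (\<lambda>d. \<bar>S h' d\<bar>)) \<le> avg UNIV (\<lambda>d. exp \<bar>S h' d\<bar>)"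
      using convex_on_sum[OF _ _ exp_convex, of UNIV "\<lambda>_::'g. 1 / L" "\<lambda>d. \<bar>S h' d\<bar>"] L
      by (simp add: avg_def L_def sum_divide_distrib[symmetric])
    also have "\<dots> \<le> avg UNIV (\<lambda>d. exp (S h' d) + exp (- S h' d))"
      by (intro avg_mono) (simp add: abs_if)
    finally show "exp (sqrt (real m) * shift_bias m h h') \<le> \<dots>" by (simp add: bias)
  qed
  also have "\<dots> = avg UNIV (\<lambda>d. avg (shifts m) (\<lambda>h'. exp (S h' d)) + avg (shifts m) (\<lambda>h'. exp (- S h' d)))"
    by (subst avg_swap) (simp add: avg_add)
  also have "\<dots> \<le> avg (UNIV :: 'g set) (\<lambda>d. exp L + exp L)"
    using exp_moment_count[OF m, of 1 h] exp_moment_count[OF m, of "-1" h]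
    by (intro avg_mono add_mono) (simp_all add: S_def L_def)
  finally show ?thesis by (simp add: avg_const L_def)
qed

text \<open>Convexity of \<open>exp\<close> between 0 and \<open>f h\<close> turns a bounded
  exponential moment into an excess over 1 that is linear in \<open>\<theta>\<close>.\<close>

lemma avg_exp_le:
  assumes H: "finite H" "H \<noteq> {}" and \<theta>: "0 \<le> \<theta>" "\<theta> \<le> 1"
    and D: "avg H (\<lambda>h. exp (f h)) \<le> D"
  shows "avg H (\<lambda>h. exp (\<theta> * f h)) \<le> 1 + \<theta> * (D - 1)"
proof -
  have "avg H (\<lambda>h. exp (\<theta> * f h)) \<le> avg H (\<lambda>h. (1 - \<theta>) + \<theta> * exp (f h))"
  proof (intro avg_mono)
    fix h
    show "exp (\<theta> * f h) \<le> (1 - \<theta>) + \<theta> * exp (f h)"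
      using convex_onD[OF exp_convex \<theta>, of 0 "f h"] by simp
  qed
  also have "\<dots> = (1 - \<theta>) + \<theta> * avg H (\<lambda>h. exp (f h))"
    using H by (simp add: avg_add avg_mult_left avg_const)
  also have "\<dots> \<le> (1 - \<theta>) + \<theta> * D" using \<theta> D by (intro add_mono mult_left_mono) auto
  finally show ?thesis by (simp add: algebra_simps)
qed

section \<open>Hard distributions\<close>

lemma pmf_bob_answer_uniform:
  assumes "finite Y" "Y \<noteq> {}"
  shows "pmf (bob_answer P t (map_pmf G (pmf_of_set Y))) v =
    measure_pmf.expectation (coins P) (\<lambda>\<omega>. avg (words t Y) (\<lambda>ys.
      of_bool (bob P \<omega> (alice P \<omega> (map (fst \<circ> G) ys)) (map (snd \<circ> G) ys) = v)))"
proof -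
  have rep: "pmf (bind_pmf (replicate_pmf t (map_pmf G (pmf_of_set Y))) f) v
      = avg (words t Y) (\<lambda>ys. pmf (f (map G ys)) v)" for f :: "(nat \<times> nat) list \<Rightarrow> bool pmf"
  proof (induction t arbitrary: f)
    case 0
    then show ?case by (simp add: bind_return_pmf avg_def)
  next
    case (Suc t)
    have "pmf (bind_pmf (replicate_pmf (Suc t) (map_pmf G (pmf_of_set Y))) f) v
      = pmf (bind_pmf (pmf_of_set Y) (\<lambda>y. bind_pmf (replicate_pmf t (map_pmf G (pmf_of_set Y)))
          (\<lambda>xs. f (G y # xs)))) v"
      by (simp add: bind_assoc_pmf bind_return_pmf bind_map_pmf)
    also have "\<dots> = avg Y (\<lambda>y. avg (words t Y) (\<lambda>ys. pmf (f (G y # map G ys)) v))"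
      using assms by (simp add: pmf_bind_pmf_of_set Suc[of "\<lambda>xs. f (G y # xs)" for y] avg_def)
    finally show ?case by (simp add: avg_words_Suc)
  qed
  show ?thesis
    unfolding bob_answer_def pmf_bind[of "coins P"] rep
    by (simp add: pmf_return comp_def of_bool_def indicator_def)
qed

text \<open>The product \<open>q \<times> r\<close> overlaps the uniform distribution on the graph of \<open>g\<close> in mass at most
  \<open>1/2\<close>: by AM-GM, \<open>min (1/N) (q r) \<le> sqrt (q r / N) \<le> q/N + r/4\<close>.\<close>

lemma graph_far_from_product:
  fixes g :: "'y \<Rightarrow> 'g::finite" and e :: "'g \<Rightarrow> nat" and f :: "'y \<Rightarrow> nat"
  assumes Y: "finite Y" "Y \<noteq> {}" and card4: "CARD('g) = 4"
    and e: "inj e" "range e \<subseteq> {1..n}" and f: "inj_on f Y" "f ` Y \<subseteq> {1..n}"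
    and balanced: "\<And>u. avg Y (\<lambda>y. u (g y)) = avg UNIV u"
  shows "far_from_product n n 1 (map_pmf (\<lambda>y. (e (g y), f y)) (pmf_of_set Y))"
  unfolding far_from_product_def
proof (intro allI impI)
  fix Q assume "product_dist_over n n Q"
  then obtain q r where q: "set_pmf q \<subseteq> {1..n}" and r: "set_pmf r \<subseteq> {1..n}" and Q: "Q = pair_pmf q r"
    unfolding product_dist_over_def by (elim exE conjE)
  define p where "p = map_pmf (\<lambda>y. (e (g y), f y)) (pmf_of_set Y)"
  define N where "N = real (card Y)"
  have N: "N > 0" using Y by (simp add: N_def card_gt_0_iff)
  let ?B = "{1..n} \<times> {1..n}"
  let ?G = "(\<lambda>y. (e (g y), f y)) ` Y"
  have inj: "inj_on (\<lambda>y. (e (g y), f y)) Y" using f(1) by (auto simp: inj_on_def)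
  have GB: "?G \<subseteq> ?B" using e f by auto
  have set_p: "set_pmf p = ?G" using Y by (simp add: p_def)
  have p_graph: "pmf p (e (g y), f y) = 1 / N" if "y \<in> Y" for y
    unfolding p_def using pmf_map_inj[of "\<lambda>y. (e (g y), f y)" "pmf_of_set Y" y] inj Y that
    by (simp add: N_def)
  have sum_p: "(\<Sum>z\<in>?B. pmf p z) = 1"
    using set_p GB by (intro sum_pmf_eq_1) auto
  have sum_Q: "(\<Sum>z\<in>?B. pmf Q z) = 1"
    using q r Q by (intro sum_pmf_eq_1) auto
  have p_0: "pmf p z = 0" if "z \<notin> ?G" for z
    using that set_p by (simp add: pmf_eq_0_set_pmf)
  have "(\<Sum>z\<in>?B. min (pmf p z) (pmf Q z)) = (\<Sum>z\<in>?G. min (pmf p z) (pmf Q z))"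
  proof (rule sum.mono_neutral_right[OF _ GB])
    show "\<forall>z\<in>?B - ?G. min (pmf p z) (pmf Q z) = 0"
      by (metis DiffD2 p_0 min.absorb1 pmf_nonneg)
  qed simp
  also have "\<dots> = (\<Sum>y\<in>Y. min (1 / N) (pmf q (e (g y)) * pmf r (f y)))"
    using inj by (simp add: sum.reindex p_graph Q pmf_pair)
  also have "\<dots> \<le> (\<Sum>y\<in>Y. pmf q (e (g y)) / N + pmf r (f y) / 4)"
  proof (intro sum_mono)
    fix y
    define a b where "a = pmf q (e (g y)) / N" and "b = pmf r (f y) / 4"
    have ab: "0 \<le> a" "0 \<le> b" using N by (simp_all add: a_def b_def)
    define v where "v = min (1 / N) (pmf q (e (g y)) * pmf r (f y))"
    have v0: "0 \<le> v" using N by (simp add: v_def)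
    have "v\<^sup>2 \<le> (1 / N) * (pmf q (e (g y)) * pmf r (f y))"
      unfolding power2_eq_square using N v0 by (intro mult_mono) (auto simp: v_def)
    also have "\<dots> = 4 * a * b" by (simp add: a_def b_def)
    also have "\<dots> \<le> (a + b)\<^sup>2" using sum_squares_bound[of a b] unfolding power2_sum by linarith
    finally show "v \<le> a + b" by (rule power2_le_imp_le) (use ab in linarith)
  qed
  also have "\<dots> = avg Y (\<lambda>y. pmf q (e (g y))) + (\<Sum>y\<in>Y. pmf r (f y)) / 4"
    by (simp add: sum.distrib sum_divide_distrib avg_def N_def)
  \<comment> \<open>By \<open>balanced\<close>, \<open>g\<close> is uniform on the 4 group elements,
    so the first average is at most 1/4; injectivity of \<open>f\<close> bounds the total of
    \<open>r\<close> by 1.\<close>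
  also have "\<dots> \<le> 1 / 4 + 1 / 4"
  proof -
    have "avg Y (\<lambda>y. pmf q (e (g y))) = (\<Sum>x\<in>range e. pmf q x) / 4"
      using balanced[of "\<lambda>a. pmf q (e a)"] e(1) by (simp add: avg_def card4 sum.reindex)
    moreover have "(\<Sum>y\<in>Y. pmf r (f y)) = (\<Sum>x\<in>f ` Y. pmf r x)"
      using f(1) by (simp add: sum.reindex)
    moreover have "sum (pmf q) (range e) \<le> 1" "sum (pmf r) (f ` Y) \<le> 1"
      using measure_measure_pmf_finite[of "range e" q] measure_measure_pmf_finite[of "f ` Y" r] Y(1)
      by (metis finite finite_imageI measure_pmf.prob_le_1)+
    ultimately show ?thesis by linarith
  qed
  finally have overlap: "(\<Sum>z\<in>?B. min (pmf p z) (pmf Q z)) \<le> 1 / 2" by simp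
  have "l1_dist n n p Q = (\<Sum>z\<in>?B. pmf p z + pmf Q z - 2 * min (pmf p z) (pmf Q z))"
    unfolding l1_dist_def by (intro sum.cong) (auto simp: min_def)
  also have "\<dots> = 2 - 2 * (\<Sum>z\<in>?B. min (pmf p z) (pmf Q z))"
    by (simp only: sum_subtractf sum.distrib sum_p sum_Q sum_distrib_left[symmetric])
  finally show "1 \<le> l1_dist n n (map_pmf (\<lambda>y. (e (g y), f y)) (pmf_of_set Y)) Q"
    using overlap by (simp add: p_def)
qed

lemma pair_pmf_of_set:
  assumes "finite A" "A \<noteq> {}" "finite B" "B \<noteq> {}"
  shows "pair_pmf (pmf_of_set A) (pmf_of_set B) = pmf_of_set (A \<times> B)"
proof (rule pmf_eqI)
  fix z :: "'a \<times> 'b"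
  show "pmf (pair_pmf (pmf_of_set A) (pmf_of_set B)) z = pmf (pmf_of_set (A \<times> B)) z"
    using assms by (cases z) (simp add: pmf_pair indicator_def)
qed

lemma card_bounded_words_le: "card {xs :: bool list. length xs \<le> k} \<le> 2 ^ (k + 1)"
proof -
  have "card {xs :: bool list. set xs \<subseteq> UNIV \<and> length xs \<le> k} = (\<Sum>i\<le>k. 2 ^ i)"
    by (subst card_lists_length_le) simp_all
  also have "\<dots> \<le> 2 ^ (k + 1)"
    by (induction k) auto
  finally show ?thesis by simp
qed

section \<open>The lower bound\<close>

lemma communication_lower_bound:
  assumes P: "solves_IT n n t 1 P" "communicates_at_most n t P k"
    and m: "16 \<le> m" "4 * m \<le> n"
  shows "sqrt (real m) \<le> 9000 * (real k + 1)"
proof -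
  let ?Y = "bob_letters m :: (nat \<times> 4) set"
  let ?H = "shifts m :: (nat \<Rightarrow> 4) set"
  have m0: "m > 0" using m by simp
  have Y: "finite ?Y" "?Y \<noteq> {}" using m0 by (auto simp: lessThan_empty_iff)
  obtain e0 :: "4 \<Rightarrow> nat" where "bij_betw e0 UNIV {0..<card (UNIV :: 4 set)}"
    using ex_bij_betw_finite_nat[of "UNIV :: 4 set"] by auto
  then have e0: "inj e0" "range e0 = {0..<4}" by (auto simp: bij_betw_def)
  define e where "e c = Suc (e0 c)" for c
  have e0_less: "e0 c < 4" for c using e0(2) by auto
  have e: "inj e" "range e \<subseteq> {1..n}"
  proof -
    show "inj e" using e0(1) by (simp add: e_def inj_def)
    show "range e \<subseteq> {1..n}"
    proof
      fix x assume "x \<in> range e"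
      then obtain c where "x = Suc (e0 c)" by (auto simp: e_def)
      then show "x \<in> {1..n}" using e0_less[of c] m by simp
    qed
  qed
  \<comment> \<open>Base-4 digits shifted by one, because \<open>e\<close> takes values in 1 to 4;
    the image lies in 1 to \<open>4 * m\<close>.\<close>
  define f where "f = (\<lambda>(i, c). 4 * i + e c)"
  have f_inj: "inj_on f ?Y"
  proof (rule inj_onI)
    fix y z assume "y \<in> ?Y" "z \<in> ?Y" and eq: "f y = f z"
    obtain i c j d where yz: "y = (i, c)" "z = (j, d)" by (cases y, cases z)
    have eq': "4 * i + e0 c = 4 * j + e0 d" using eq by (simp add: f_def e_def yz)
    have "i = j" using arg_cong[OF eq', of "\<lambda>x. x div 4"] e0_less by simp
    moreover from this have "c = d" using eq' e0(1) by (simp add: inj_def)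
    ultimately show "y = z" by (simp add: yz)
  qed
  have f_range: "f ` ?Y \<subseteq> {1..n}"
  proof
    fix x assume "x \<in> f ` ?Y"
    then obtain i c where "i < m" "x = 4 * i + Suc (e0 c)" by (auto simp: f_def e_def)
    then show "x \<in> {1..n}" using e0_less[of c] m by simp
  qed
  define a where "a \<omega> x = alice P \<omega> (map e x)" for \<omega> x
  \<comment> \<open>Indicates the answer "not product", so \<open>no\<close> and \<open>yes\<close>
    are Bob's rejection probabilities in the far and the product case for fixed coins.\<close>
  define b where "b \<omega> c ys = (of_bool (\<not> bob P \<omega> c (map f ys)) :: real)" for \<omega> c ys
  define no where "no h \<omega> = avg (words t ?Y) (\<lambda>ys. b \<omega> (a \<omega> (map (hidden h) ys)) ys)" for h \<omega>
  define yes where "yes \<omega> = avg (words t ?Y) (\<lambda>ys. avg (words t UNIV) (\<lambda>x. b \<omega> (a \<omega> x) ys))" for \<omega>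
  let ?E = "measure_pmf.expectation (coins P)"
  have bounds: "0 \<le> no h \<omega>" "no h \<omega> \<le> 1" "0 \<le> yes \<omega>" "yes \<omega> \<le> 1" for h \<omega>
  proof -
    have YW: "finite (words t ?Y)" "words t ?Y \<noteq> {}" using Y by (simp_all add: words_nonempty)
    have XW: "finite (words t (UNIV :: 4 set))" "words t (UNIV :: 4 set) \<noteq> {}" by (simp_all add: words_nonempty)
    show "0 \<le> no h \<omega>" "0 \<le> yes \<omega>" by (simp_all add: no_def yes_def b_def avg_nonneg)
    show "no h \<omega> \<le> 1"
      unfolding no_def by (subst (2) avg_const[OF YW, symmetric]) (auto intro: avg_mono simp: b_def)
    have "avg (words t UNIV) (\<lambda>x. b \<omega> (a \<omega> x) ys) \<le> 1" for ys
      by (subst (2) avg_const[OF XW, symmetric]) (auto intro: avg_mono simp: b_def)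
    then show "yes \<omega> \<le> 1"
      unfolding yes_def by (subst (3) avg_const[OF YW, symmetric]) (auto intro: avg_mono)
  qed
  have int_no: "integrable (coins P) (no h)" and int_yes: "integrable (coins P) yes" for h
    using bounds by (auto intro!: measure_pmf.integrable_const_bound[where B = 1])
  have no_ge: "2 / 3 \<le> ?E (no h)" for h
  proof -
    let ?p = "map_pmf (\<lambda>y. (e (hidden h y), f y)) (pmf_of_set ?Y)"
    have "far_from_product n n 1 ?p"
      by (rule graph_far_from_product[OF Y _ e f_inj f_range avg_hidden[OF m0]]) simp
    moreover have "dist_over n n ?p"
      using Y e f_range by (auto simp: dist_over_def)
    ultimately have "2 / 3 \<le> pmf (bob_answer P t ?p) False"
      using P(1) by (simp add: solves_IT_def measure_pmf_single)
    also have "\<dots> = ?E (no h)"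
      unfolding pmf_bob_answer_uniform[OF Y] no_def a_def b_def by (simp add: comp_def)
    finally show ?thesis .
  qed
  have yes_le: "?E yes \<le> 1 / 3"
  proof -
    let ?p = "map_pmf (\<lambda>z. (e (fst z), f (snd z))) (pmf_of_set (UNIV \<times> ?Y))"
    have p: "?p = pair_pmf (map_pmf e (pmf_of_set UNIV)) (map_pmf f (pmf_of_set ?Y))"
      using Y by (simp add: pair_pmf_of_set[symmetric] map_pair[symmetric] case_prod_unfold)
    have "product_dist_over n n ?p"
      unfolding product_dist_over_def
      by (intro exI[of _ "map_pmf e (pmf_of_set UNIV)"] exI[of _ "map_pmf f (pmf_of_set ?Y)"])
         (use p e f_range Y in auto)
    moreover have "dist_over n n ?p"
      using Y e f_range by (auto simp: dist_over_def)
    ultimately have "2 / 3 \<le> pmf (bob_answer P t ?p) True"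
      using P(1) by (simp add: solves_IT_def measure_pmf_single)
    then have "pmf (bob_answer P t ?p) False \<le> 1 / 3"
      by (simp add: pmf_False_conv_True)
    also have "pmf (bob_answer P t ?p) False = ?E yes"
    proof (subst pmf_bob_answer_uniform)
      have "yes = (\<lambda>\<omega>. avg (words t (UNIV \<times> ?Y)) (\<lambda>zs. b \<omega> (a \<omega> (map fst zs)) (map snd zs)))"
        unfolding yes_def[abs_def]
        using avg_words_Times[of t UNIV ?Y "\<lambda>xs ys. b \<omega> (a \<omega> xs) ys" for \<omega>] by simp
      then show "?E (\<lambda>\<omega>. avg (words t (UNIV \<times> ?Y)) (\<lambda>ys. of_bool
          (bob P \<omega> (alice P \<omega> (map (fst \<circ> (\<lambda>z. (e (fst z), f (snd z)))) ys))
            (map (snd \<circ> (\<lambda>z. (e (fst z), f (snd z)))) ys) = False))) = ?E yes"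
        by (simp add: a_def b_def comp_def)
    qed (use Y in auto)
    finally show ?thesis .
  qed
  have "1 / 3 \<le> avg ?H (\<lambda>h. ?E (no h)) - ?E yes"
  proof -
    have "avg ?H (\<lambda>_. 2 / 3) \<le> avg ?H (\<lambda>h. ?E (no h))" by (intro avg_mono no_ge)
    then show ?thesis using yes_le by (simp add: avg_const)
  qed
  also have "\<dots> = ?E (\<lambda>\<omega>. avg ?H (\<lambda>h. no h \<omega>) - yes \<omega>)"
    using int_no int_yes by (simp add: avg_def)
  finally have gap: "1 / 3 \<le> ?E (\<lambda>\<omega>. avg ?H (\<lambda>h. no h \<omega>) - yes \<omega>)" .
  \<comment> \<open>The coins are fixed by averaging: a gap of 1/3 in expectation is attained by
    some coin string, with \<open>h\<close> still random.\<close>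
  obtain \<omega> where \<omega>: "\<omega> \<in> set_pmf (coins P)" "1 / 3 \<le> avg ?H (\<lambda>h. no h \<omega>) - yes \<omega>"
  proof (rule ccontr)
    assume "\<not> thesis"
    with that have less: "avg ?H (\<lambda>h. no h \<omega>) - yes \<omega> < 1 / 3" if "\<omega> \<in> set_pmf (coins P)" for \<omega>
      using that by force
    have "?E (\<lambda>\<omega>. avg ?H (\<lambda>h. no h \<omega>) - yes \<omega>) < ?E (\<lambda>\<omega>. 1 / 3)"
    proof (rule measure_pmf.integral_less_AE_space)
      show "integrable (coins P) (\<lambda>\<omega>. avg ?H (\<lambda>h. no h \<omega>) - yes \<omega>)"
        using int_no int_yes by (auto simp: avg_def)
    qed (use less in \<open>auto simp: AE_measure_pmf_iff\<close>)
    with gap show False by simp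
  qed
  define M where "M = a \<omega> ` words t UNIV"
  have "M \<subseteq> {xs. length xs \<le> k}"
  proof
    fix c assume "c \<in> M"
    then obtain x where x: "x \<in> words t UNIV" "c = alice P \<omega> (map e x)" by (auto simp: M_def a_def)
    have "set (map e x) \<subseteq> {1..n} \<and> length (map e x) = t" using x e(2) by (auto simp: words_def)
    then show "c \<in> {xs. length xs \<le> k}" using P(2) \<omega>(1) x(2) by (auto simp: communicates_at_most_def)
  qed
  moreover have "finite {xs :: bool list. length xs \<le> k}"
    using finite_lists_length_le[of "UNIV :: bool set" k] by simp
  ultimately have "card M \<le> card {xs :: bool list. length xs \<le> k}"
    by (intro card_mono)
  then have "card M \<le> 2 ^ (k + 1)"
    using card_bounded_words_le by (rule le_trans)
  then have "real (card M) \<le> real (2 ^ (k + 1))" by (rule of_nat_mono)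
  then have card_M: "real (card M) \<le> 2 ^ (k + 1)" by simp
  \<comment> \<open>The 8 is \<open>2 * CARD(4)\<close>. As \<open>card M\<close> is at most
    \<open>exp (k + 1)\<close>, the power of \<open>card M\<close> is at most the exponential of
    \<open>\<theta>\<close> times the scaled bias.\<close>
  define \<theta> where "\<theta> = 8 * (real k + 1) / sqrt (real m)"
  have \<theta>0: "0 \<le> \<theta>" by (simp add: \<theta>_def)
  have sm: "sqrt (real m) > 0" using m0 by simp
  show ?thesis
  proof (cases "\<theta> \<le> 1")
    case False
    then have "sqrt (real m) \<le> 8 * (real k + 1)" using sm by (simp add: \<theta>_def field_simps)
    then show ?thesis by simp
  next
    case True
    have "(1 / 3)\<^sup>2 \<le> (avg ?H (\<lambda>h. no h \<omega>) - yes \<omega>)\<^sup>2"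
      using \<omega>(2) by (intro power_mono) auto
    also have "\<dots> \<le> avg ?H (\<lambda>h. avg ?H (\<lambda>h'. real (card M) powr (2 * real CARD(4) * shift_bias m h h'))) - 1"
      unfolding no_def yes_def M_def
      by (rule advantage_le[OF m0]) (auto simp: b_def)
    also have "\<dots> \<le> avg ?H (\<lambda>h. 1 + \<theta> * (2 * exp 4 - 1)) - 1"
    proof (intro diff_right_mono avg_mono)
      fix h :: "nat \<Rightarrow> 4"
      have "real (card M) powr (2 * real CARD(4) * shift_bias m h h')
          \<le> exp (\<theta> * (sqrt (real m) * shift_bias m h h'))" for h'
      proof -
        have "real (card M) \<le> exp 1 ^ (k + 1)"
          using card_M exp_ge_add_one_self[of "1::real"] power_mono[of 2 "exp 1 :: real" "k + 1"] by linarith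
        also have "\<dots> = exp (real k + 1)" using exp_of_nat_mult[of "k + 1" "1 :: real"] by (simp add: add.commute)
        finally have "real (card M) powr (8 * shift_bias m h h')
            \<le> exp (real k + 1) powr (8 * shift_bias m h h')"
          by (intro powr_mono2) (auto simp: shift_bias_nonneg)
        also have "\<dots> = exp (\<theta> * (sqrt (real m) * shift_bias m h h'))"
          using sm by (simp add: \<theta>_def powr_def mult_ac)
        finally show ?thesis by simp
      qed
      then have "avg ?H (\<lambda>h'. real (card M) powr (2 * real CARD(4) * shift_bias m h h'))
        \<le> avg ?H (\<lambda>h'. exp (\<theta> * (sqrt (real m) * shift_bias m h h')))"
        by (rule avg_mono)
      also have "\<dots> \<le> 1 + \<theta> * (2 * exp 4 - 1)"
        using exp_moment_shift_bias[of m h] m by (intro avg_exp_le \<theta>0 True) auto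
      finally show "avg ?H (\<lambda>h'. real (card M) powr (2 * real CARD(4) * shift_bias m h h'))
        \<le> 1 + \<theta> * (2 * exp 4 - 1)" .
    qed
    also have "\<dots> = \<theta> * (2 * exp 4 - 1)" by (simp add: avg_const)
    also have "\<dots> \<le> \<theta> * 125"
    proof (intro mult_left_mono \<theta>0)
      have "exp (4::real) = exp 1 ^ 4" using exp_of_nat_mult[of 4 "1 :: real"] by simp
      also have "\<dots> \<le> (272 / 100) ^ 4" using e_less_272 by (intro power_mono) auto
      finally show "2 * exp 4 - 1 \<le> (125::real)" by (simp add: power4_eq_xxxx)
    qed
    \<comment> \<open>From \<open>1 / 9 \<le> 125 * \<theta>\<close>; with the 8 in
      \<open>\<theta>\<close> this yields the constant 9000.\<close>
    finally have "1 \<le> 1125 * \<theta>" by (simp add: power2_eq_square)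
    then show ?thesis using sm by (simp add: \<theta>_def field_simps)
  qed
qed

theorem mainTheorem4:
  "\<exists>c::real. c > 0 \<and>
     (\<exists>n0::nat. \<forall>n\<ge>n0. \<forall>t::nat. \<forall>(P::one_way_protocol) (k::nat).
        solves_IT n n t 1 P \<and> communicates_at_most n t P k \<longrightarrow>
          real k \<ge> c * sqrt (real n))"
\<comment> \<open>With \<open>m = n div 4\<close> and \<open>n \<le> 9 * m\<close>, the bound reads
  \<open>sqrt n \<le> 27000 * k + 27000\<close>. The threshold on \<open>n\<close> makes the
  additive term at most half of \<open>sqrt n\<close>, which doubles 27000 to 54000.\<close>
proof (intro exI[of _ "1 / 54000"] exI[of _ "54000\<^sup>2"] conjI allI impI; (elim conjE)?)
  show "0 < (1 / 54000 :: real)" by simp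
  fix n t P k
  assume n: "54000\<^sup>2 \<le> n" and P: "solves_IT n n t 1 P" "communicates_at_most n t P k"
  have nm: "real n \<le> 9 * real (n div 4)" and m16: "16 \<le> n div 4"
    using n by (simp_all add: power2_eq_square)
  have "sqrt (real n) \<le> sqrt (9 * real (n div 4))"
    using nm by simp
  also have "\<dots> = 3 * sqrt (real (n div 4))"
    by (simp add: real_sqrt_mult)
  also have "\<dots> \<le> 27000 * (real k + 1)"
    using communication_lower_bound[OF P m16] by simp
  finally have "sqrt (real n) \<le> 27000 * real k + 27000" by simp
  moreover have "54000 \<le> sqrt (real n)"
    using n by (intro real_le_rsqrt) (metis of_nat_le_iff of_nat_numeral of_nat_power)
  ultimately show "1 / 54000 * sqrt (real n) \<le> real k" by simp
qed

end
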